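(* For $n\geq 2$, $a_n(132;321) = \left\lceil \frac{(n-2)^2}{2}\right\rceil + 1$.
   Context: $\mathcal{S}_n$ is the set of permutations of $[n]=\{1,\dots,n\}$, written in one-line notation $\pi=\pi_1\pi_2\cdots\pi_n$ with $\pi_i=\pi(i)$. A permutation is cyclic if it consists of exactly one $n$-cycle. For a cyclic $\pi$, its standard cycle notation is $C(\pi)=(c_1,c_2,\dots,c_n)$ with $c_1=1$ and $c_i=\pi_{c_{i-1}}$ for $2\le i\le n$. A sequence of distinct integers $w_1\cdots w_m$ contains a pattern $\sigma\in\mathcal{S}_k$ if there are indices $i_1<\dots<i_k$ with $w_{i_1}\cdots w_{i_k}$ in the same relative order as $\sigma_1\cdots\sigma_k$; otherwise it avoids $\sigma$. For $\sigma,\tau\in\mathcal{S}_3$, $\mathcal{A}_n(\sigma;\tau)$ is the set of cyclic permutations $\pi\in\mathcal{S}_n$ whose one-line notation avoids $\sigma$ and whose cycle notation $C(\pi)$ (as the sequence $c_1c_2\cdots c_n$) avoids $\tau$; $a_n(\sigma;\tau)=|\mathcal{A}_n(\sigma;\tau)|$. *)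

theory Defs
  imports Complex_Main "HOL-Combinatorics.Combinatorics"
begin

definition pattern_contains :: "nat list \<Rightarrow> nat list \<Rightarrow> bool" where
  "pattern_contains w \<sigma> \<longleftrightarrow>
     (\<exists>i :: nat \<Rightarrow> nat. strict_mono_on {..<length \<sigma>} i
        \<and> (\<forall>a<length \<sigma>. i a < length w)
        \<and> (\<forall>a<length \<sigma>. \<forall>b<length \<sigma>. w ! i a < w ! i b \<longleftrightarrow> \<sigma> ! a < \<sigma> ! b))"

definition pattern_avoids :: "nat list \<Rightarrow> nat list \<Rightarrow> bool" where
  "pattern_avoids w \<sigma> \<longleftrightarrow> \<not> pattern_contains w \<sigma>"

definition one_line :: "nat \<Rightarrow> (nat \<Rightarrow> nat) \<Rightarrow> nat list" where
  "one_line n \<pi> = map \<pi> [1..<Suc n]"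

text \<open>The entries of the standard cycle notation are \<open>c\<^sub>1 = 1\<close> and \<open>c\<^sub>i = \<pi> c\<^bsub>i-1\<^esub>\<close>,
  that is, \<open>c\<^sub>i\<close> is the \<open>(i-1)\<close>-fold iterate of \<open>\<pi>\<close> at \<open>1\<close>.
  The list is the cycle notation only for a cyclic \<open>\<pi>\<close>.\<close>

definition cycle_notation :: "nat \<Rightarrow> (nat \<Rightarrow> nat) \<Rightarrow> nat list" where
  "cycle_notation n \<pi> = map (\<lambda>i. (\<pi> ^^ i) 1) [0..<n]"

text \<open>Permutations of \<open>{1..n}\<close> are functions on \<open>nat\<close> that are the identity outside \<open>{1..n}\<close>
  (this is part of \<open>permutes\<close>), so distinct permutations are distinct functions.
  The condition \<open>cyclic_on \<pi> {1..n}\<close> says that \<open>{1..n}\<close> is a single orbit of \<open>\<pi>\<close>.\<close>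

definition cyclic_avoiders :: "nat \<Rightarrow> nat list \<Rightarrow> nat list \<Rightarrow> (nat \<Rightarrow> nat) set" where
  "cyclic_avoiders n \<sigma> \<tau> =
     {\<pi>. \<pi> permutes {1..n} \<and> cyclic_on \<pi> {1..n}
        \<and> pattern_avoids (one_line n \<pi>) \<sigma>
        \<and> pattern_avoids (cycle_notation n \<pi>) \<tau>}"

definition num_cyclic_avoiders :: "nat \<Rightarrow> nat list \<Rightarrow> nat list \<Rightarrow> nat" where
  "num_cyclic_avoiders n \<sigma> \<tau> = card (cyclic_avoiders n \<sigma> \<tau>)"

end

theory Submission
  imports Defs
begin

text \<open>Let \<open>k\<close> be the last entry of the cycle notation, so \<open>\<pi> k = 1\<close>. Avoidance of 321 makes the
  entries greater than \<open>k\<close>, those before \<open>2\<close> and those after \<open>n\<close> increase along the cycle;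
  combined with avoidance of 132 in one-line notation this forces every value to the left of \<open>1\<close> to
  exceed every value to the right of it, whence \<open>\<pi> (k + i) = i + 1\<close> for \<open>0 \<le> i \<le> m = n - k\<close>.

  If \<open>m = 0\<close>, deleting \<open>n\<close> from the end of the cycle is a bijection onto the avoiders of size
  \<open>n - 1\<close>. If \<open>m \<ge> 2\<close>, then \<open>2 m + 1 \<le> n\<close> and \<open>\<pi>\<close> is determined by \<open>m\<close>. If \<open>m = 1\<close>, then \<open>\<pi>\<close> is
  determined by \<open>\<pi> 1\<close>, which can be any \<open>x \<ge> 3\<close> with \<open>n - x\<close> even. Hence
  \<open>a\<^sub>n = a\<^bsub>n-1\<^esub> + 2 \<lfloor>(n - 1) / 2\<rfloor> - 1\<close> for \<open>n \<ge> 3\<close>.\<close>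

section \<open>Pattern containment as inequalities between three entries\<close>

lemma pattern_contains_132_iff:
  "pattern_contains w [1, 3, 2] \<longleftrightarrow>
     (\<exists>i j l. i < j \<and> j < l \<and> l < length w \<and> w ! i < w ! l \<and> w ! l < w ! j)"
proof
  assume "pattern_contains w [1, 3, 2]"
  then obtain f where f: "strict_mono_on {..<3} f" "\<And>a. a < 3 \<Longrightarrow> f a < length w"
    "\<And>a b. a < 3 \<Longrightarrow> b < 3 \<Longrightarrow> w ! f a < w ! f b \<longleftrightarrow> [1,3,2::nat] ! a < [1,3,2] ! b"
    by (auto simp: pattern_contains_def numeral_3_eq_3)
  have "f 0 < f 1" "f 1 < f 2" using f(1) by (auto simp: strict_mono_on_def)
  moreover have "w ! f 0 < w ! f 2" "w ! f 2 < w ! f 1" using f(3)[of 0 2] f(3)[of 2 1] by auto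
  ultimately show "\<exists>i j l. i < j \<and> j < l \<and> l < length w \<and> w ! i < w ! l \<and> w ! l < w ! j"
    using f(2)[of 2] by auto
next
  assume "\<exists>i j l. i < j \<and> j < l \<and> l < length w \<and> w ! i < w ! l \<and> w ! l < w ! j"
  then obtain i j l where ijl: "i < j" "j < l" "l < length w" "w ! i < w ! l" "w ! l < w ! j"
    by blast
  show "pattern_contains w [1, 3, 2]"
    unfolding pattern_contains_def
    using ijl by (intro exI[of _ "\<lambda>a. [i, j, l] ! a"])
      (auto simp: strict_mono_on_def less_Suc_eq numeral_3_eq_3)
qed

lemma pattern_contains_321_iff:
  "pattern_contains w [3, 2, 1] \<longleftrightarrow>
     (\<exists>i j l. i < j \<and> j < l \<and> l < length w \<and> w ! l < w ! j \<and> w ! j < w ! i)"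
proof
  assume "pattern_contains w [3, 2, 1]"
  then obtain f where f: "strict_mono_on {..<3} f" "\<And>a. a < 3 \<Longrightarrow> f a < length w"
    "\<And>a b. a < 3 \<Longrightarrow> b < 3 \<Longrightarrow> w ! f a < w ! f b \<longleftrightarrow> [3,2,1::nat] ! a < [3,2,1] ! b"
    by (auto simp: pattern_contains_def numeral_3_eq_3)
  have "f 0 < f 1" "f 1 < f 2" using f(1) by (auto simp: strict_mono_on_def)
  moreover have "w ! f 2 < w ! f 1" "w ! f 1 < w ! f 0" using f(3)[of 2 1] f(3)[of 1 0] by auto
  ultimately show "\<exists>i j l. i < j \<and> j < l \<and> l < length w \<and> w ! l < w ! j \<and> w ! j < w ! i"
    using f(2)[of 2] by auto
next
  assume "\<exists>i j l. i < j \<and> j < l \<and> l < length w \<and> w ! l < w ! j \<and> w ! j < w ! i"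
  then obtain i j l where ijl: "i < j" "j < l" "l < length w" "w ! l < w ! j" "w ! j < w ! i"
    by blast
  show "pattern_contains w [3, 2, 1]"
    unfolding pattern_contains_def
    using ijl by (intro exI[of _ "\<lambda>a. [i, j, l] ! a"])
      (auto simp: strict_mono_on_def less_Suc_eq numeral_3_eq_3)
qed

lemma one_line_avoids_132_iff:
  "pattern_avoids (one_line n \<pi>) [1, 3, 2] \<longleftrightarrow>
     (\<forall>i j l. 1 \<le> i \<longrightarrow> i < j \<longrightarrow> j < l \<longrightarrow> l \<le> n \<longrightarrow> \<pi> i < \<pi> l \<longrightarrow> \<not> \<pi> l < \<pi> j)"
    (is "?L \<longleftrightarrow> ?R")
proof -
  have len: "length (one_line n \<pi>) = n" and nth: "\<And>i. i < n \<Longrightarrow> one_line n \<pi> ! i = \<pi> (Suc i)"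
    by (auto simp: one_line_def nth_append simp del: upt_Suc)
  show ?thesis
  proof
    assume L: ?L
    show ?R
    proof (intro allI impI notI)
      fix i j l assume *: "1 \<le> i" "i < j" "j < l" "l \<le> n" "\<pi> i < \<pi> l" "\<pi> l < \<pi> j"
      have "pattern_contains (one_line n \<pi>) [1, 3, 2]"
        unfolding pattern_contains_132_iff len
        using * by (intro exI[of _ "i - 1"] exI[of _ "j - 1"] exI[of _ "l - 1"]) (auto simp: nth)
      then show False using L by (simp add: pattern_avoids_def)
    qed
  next
    assume R: ?R
    show ?L unfolding pattern_avoids_def
    proof
      assume "pattern_contains (one_line n \<pi>) [1, 3, 2]"
      then obtain i j l where *: "i < j" "j < l" "l < n" "\<pi> (Suc i) < \<pi> (Suc l)"
        "\<pi> (Suc l) < \<pi> (Suc j)"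
        unfolding pattern_contains_132_iff len by (auto simp: nth)
      then show False using R[rule_format, of "Suc i" "Suc j" "Suc l"] by auto
    qed
  qed
qed

lemma cycle_notation_contains_321_iff:
  "pattern_contains (cycle_notation n \<pi>) [3, 2, 1] \<longleftrightarrow>
     (\<exists>i j l. i < j \<and> j < l \<and> l < n \<and> (\<pi> ^^ l) 1 < (\<pi> ^^ j) 1 \<and> (\<pi> ^^ j) 1 < (\<pi> ^^ i) 1)"
proof -
  have len: "length (cycle_notation n \<pi>) = n"
    and nth: "\<And>i. i < n \<Longrightarrow> cycle_notation n \<pi> ! i = (\<pi> ^^ i) 1"
    by (simp_all add: cycle_notation_def)
  show ?thesis unfolding pattern_contains_321_iff len
    by (intro ex_cong1 conj_cong refl) (simp_all add: nth)
qed

section \<open>Avoiders described by the index of each entry in the cycle\<close>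

text \<open>Here \<open>d y\<close> is the 0-based index of \<open>y\<close> in the cycle notation of \<open>\<pi>\<close>. Recursion along \<open>\<pi>\<close>
  determines \<open>d\<close>, and its existence makes \<open>\<pi>\<close> cyclic.\<close>

locale avoider =
  fixes n :: nat and \<pi> :: "nat \<Rightarrow> nat" and d :: "nat \<Rightarrow> nat"
  assumes n_pos: "1 \<le> n"
    and perm: "\<pi> permutes {1..n}"
    and d_1: "d 1 = 0"
    and d_less: "\<lbrakk>1 \<le> y; y \<le> n\<rbrakk> \<Longrightarrow> d y < n"
    and d_step: "\<lbrakk>1 \<le> y; y \<le> n; \<pi> y \<noteq> 1\<rbrakk> \<Longrightarrow> d (\<pi> y) = Suc (d y)"
    and no_132: "\<lbrakk>1 \<le> i; i < j; j < l; l \<le> n; \<pi> i < \<pi> l\<rbrakk> \<Longrightarrow> \<not> \<pi> l < \<pi> j"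
    and no_321: "\<lbrakk>1 \<le> e; e < b; b < a; a \<le> n; d a < d b\<rbrakk> \<Longrightarrow> \<not> d b < d e"
begin

lemma ran: "1 \<le> y \<Longrightarrow> y \<le> n \<Longrightarrow> 1 \<le> \<pi> y \<and> \<pi> y \<le> n"
  using permutes_in_image[OF perm, of y] by auto

lemma inj: "\<pi> x = \<pi> y \<Longrightarrow> x = y"
  using permutes_inj[OF perm] by (auto dest: injD)

lemma preimage:
  assumes "1 \<le> v" "v \<le> n" obtains x where "1 \<le> x" "x \<le> n" "\<pi> x = v"
  using assms permutes_image[OF perm] by (metis atLeastAtMost_iff imageE)

lemma d_pos: "1 \<le> y \<Longrightarrow> y \<le> n \<Longrightarrow> y \<noteq> 1 \<Longrightarrow> 0 < d y"
  by (metis preimage d_step zero_less_Suc)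

text \<open>Passing to the preimage lowers \<open>d\<close> by one until index 0 is reached, which
  \<open>d_pos\<close> reserves for 1.\<close>

lemma funpow_d: "1 \<le> y \<Longrightarrow> y \<le> n \<Longrightarrow> (\<pi> ^^ d y) 1 = y"
proof (induction "d y" arbitrary: y)
  case 0
  then show ?case using d_pos[of y] by auto
next
  case (Suc j)
  then have "y \<noteq> 1" using d_1 by auto
  obtain x where x: "1 \<le> x" "x \<le> n" "\<pi> x = y" using preimage Suc.prems by blast
  then have "d x = j" using Suc.hyps(2) d_step[of x] \<open>y \<noteq> 1\<close> by auto
  then have "(\<pi> ^^ d x) 1 = x" using Suc.hyps(1)[of x] x by auto
  then show ?case using d_step[of x] x \<open>y \<noteq> 1\<close> by auto
qed

lemma d_inj: "\<lbrakk>d x = d y; 1 \<le> x; x \<le> n; 1 \<le> y; y \<le> n\<rbrakk> \<Longrightarrow> x = y"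
  by (metis funpow_d)

text \<open>\<open>d\<close> is injective on \<open>n\<close> elements with fewer than
  \<open>n + 1\<close> possible values, so counting makes it onto.\<close>

lemma d_image: "d ` {1..n} = {..<n}"
proof (rule card_subset_eq)
  show "d ` {1..n} \<subseteq> {..<n}" using d_less by auto
  have "inj_on d {1..n}" by (auto intro!: inj_onI d_inj)
  then show "card (d ` {1..n}) = card {..<n}" by (simp add: card_image)
qed auto

lemma cyclic: "cyclic_on \<pi> {1..n}"
proof -
  have p: "permutation \<pi>" using perm permutation_permutes by blast
  have "orbit \<pi> 1 = {1..n}"
  proof
    show "orbit \<pi> 1 \<subseteq> {1..n}" using permutes_orbit_subset[OF perm, of 1] n_pos by auto
    show "{1..n} \<subseteq> orbit \<pi> 1"
    proof
      fix y assume "y \<in> {1..n}"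
      then have "y = (\<pi> ^^ d y) 1" using funpow_d by auto
      then show "y \<in> orbit \<pi> 1" unfolding orbit_altdef_permutation[OF p] by blast
    qed
  qed
  then show ?thesis using n_pos by (intro cyclic_on_singleI[of 1]) auto
qed

lemma cycle_avoids: "pattern_avoids (cycle_notation n \<pi>) [3, 2, 1]"
  unfolding pattern_avoids_def
proof
  assume "pattern_contains (cycle_notation n \<pi>) [3, 2, 1]"
  then obtain i j l where *: "i < j" "j < l" "l < n" "(\<pi> ^^ l) 1 < (\<pi> ^^ j) 1"
    "(\<pi> ^^ j) 1 < (\<pi> ^^ i) 1"
    unfolding cycle_notation_contains_321_iff by blast
  have ex: "\<exists>y. 1 \<le> y \<and> y \<le> n \<and> d y = i" if "i < n" for i
    using d_image that by (metis atLeastAtMost_iff imageE lessThan_iff)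
  obtain a where a: "1 \<le> a" "a \<le> n" "d a = i" using ex[of i] * by auto
  obtain b where b: "1 \<le> b" "b \<le> n" "d b = j" using ex[of j] * by auto
  obtain e where e: "1 \<le> e" "e \<le> n" "d e = l" using ex[of l] * by auto
  have "b < a" "e < b" using * funpow_d a b e by auto
  then show False using no_321[of e b a] * a b e by simp
qed

end

text \<open>This trades iterates of \<open>\<pi>\<close> for inequalities about \<open>d\<close>.
  From a cyclic \<open>\<pi>\<close>, \<open>d\<close> arises by inverting
  \<open>i \<mapsto> (\<pi> ^^ i) 1\<close> on one period.\<close>

lemma cyclic_avoiders_iff:
  assumes "1 \<le> n"
  shows "\<pi> \<in> cyclic_avoiders n [1, 3, 2] [3, 2, 1] \<longleftrightarrow> (\<exists>d. avoider n \<pi> d)"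
proof
  assume "\<exists>d. avoider n \<pi> d"
  then obtain d where "avoider n \<pi> d" by blast
  interpret avoider n \<pi> d by fact
  show "\<pi> \<in> cyclic_avoiders n [1, 3, 2] [3, 2, 1]"
    unfolding cyclic_avoiders_def one_line_avoids_132_iff
    using perm cyclic cycle_avoids no_132 by blast
next
  assume "\<pi> \<in> cyclic_avoiders n [1, 3, 2] [3, 2, 1]"
  then have perm: "\<pi> permutes {1..n}" and cyc: "cyclic_on \<pi> {1..n}"
    and a132: "pattern_avoids (one_line n \<pi>) [1, 3, 2]"
    and a321: "pattern_avoids (cycle_notation n \<pi>) [3, 2, 1]"
    by (auto simp: cyclic_avoiders_def)
  define c where "c i = (\<pi> ^^ i) 1" for i
  have orb: "orbit \<pi> 1 = {1..n}" using orbit_cyclic_eq3[OF cyc] assms by auto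
  then have self: "1 \<in> orbit \<pi> 1" using assms by auto
  \<comment> \<open>The length of the orbit of 1; comparing cardinalities identifies it with
    \<open>n\<close>.\<close>
  let ?m = "funpow_dist1 \<pi> 1 1"
  have img: "c ` {0..<?m} = {1..n}"
    using orbit_conv_funpow_dist1[OF self] orb by (simp add: c_def)
  have injc: "inj_on c {0..<?m}" using inj_on_funpow_dist1[OF self] by (simp add: c_def[abs_def])
  have m: "?m = n" using card_image[OF injc] img by simp
  have cn: "c n = 1" using funpow_dist1_prop[OF self] unfolding m c_def .
  have injc: "inj_on c {0..<n}" and img: "c ` {0..<n} = {1..n}"
    using injc img m by auto
  define d where "d = the_inv_into {0..<n} c"
  have dc: "d (c i) = i" if "i < n" for i
    using the_inv_into_f_f[OF injc] that by (simp add: d_def)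
  have ex: "\<exists>i<n. y = c i" if "1 \<le> y" "y \<le> n" for y
    using that img by (metis atLeastAtMost_iff atLeastLessThan_iff imageE)
  have "avoider n \<pi> d"
  proof
    show "1 \<le> n" by fact
    show "\<pi> permutes {1..n}" by fact
    show "d 1 = 0" using dc[of 0] assms by (simp add: c_def)
    show "d y < n" if "1 \<le> y" "y \<le> n" for y using ex[OF that] dc by auto
    show "d (\<pi> y) = Suc (d y)" if y: "1 \<le> y" "y \<le> n" "\<pi> y \<noteq> 1" for y
    proof -
      obtain i where i: "i < n" "y = c i" using ex y by blast
      have s: "\<pi> y = c (Suc i)" using i by (simp add: c_def)
      then have "Suc i \<noteq> n" using cn y by auto
      then show ?thesis using dc i s by simp
    qed
    show "\<not> \<pi> l < \<pi> j" if "1 \<le> i" "i < j" "j < l" "l \<le> n" "\<pi> i < \<pi> l" for i j l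
      using a132 that unfolding one_line_avoids_132_iff by blast
    show "\<not> d b < d e" if *: "1 \<le> e" "e < b" "b < a" "a \<le> n" "d a < d b" for a b e
    proof
      assume "d b < d e"
      obtain i j l where "i < n" "a = c i" "j < n" "b = c j" "l < n" "e = c l"
        using ex[of a] ex[of b] ex[of e] * by auto
      then have "pattern_contains (cycle_notation n \<pi>) [3, 2, 1]"
        unfolding cycle_notation_contains_321_iff using * \<open>d b < d e\<close> dc
        by (intro exI[of _ i] exI[of _ j] exI[of _ l]) (simp add: c_def)
      then show False using a321 by (simp add: pattern_avoids_def)
    qed
  qed
  then show "\<exists>d. avoider n \<pi> d" by blast
qed

subsection \<open>The values around 1\<close>

context avoider
begin

text \<open>Some entry has index \<open>n - 1\<close>. Its image must be 1, since any other image
  would have index \<open>n\<close>.\<close>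

lemma last_entry:
  assumes "1 \<le> k" "k \<le> n" "\<pi> k = 1"
  shows "d k = n - 1"
proof -
  have "n - 1 \<in> d ` {1..n}" using d_image n_pos by auto
  then obtain y where y: "1 \<le> y" "y \<le> n" "d y = n - 1" by auto
  have "\<pi> y = 1" using d_step[of y] d_less[of "\<pi> y"] ran[of y] y by fastforce
  then show ?thesis using inj assms y by metis
qed

lemma d_less_last:
  assumes "1 \<le> k" "k \<le> n" "\<pi> k = 1" "1 \<le> y" "y \<le> n" "y \<noteq> k"
  shows "d y < d k"
  using last_entry[OF assms(1-3)] d_less[of y] d_inj[of y k] assms by force

lemma no_fixpoint: "2 \<le> n \<Longrightarrow> 1 \<le> y \<Longrightarrow> y \<le> n \<Longrightarrow> \<pi> y \<noteq> y"
  using d_step[of y] last_entry[of y] d_1 by (cases "y = 1") auto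

text \<open>\<open>k\<close> ends the cycle, so a descent among larger entries followed by
  \<open>k\<close> would be a 321.\<close>

lemma less_above_last:
  assumes "1 \<le> k" "\<pi> k = 1" "k < a" "a < b" "b \<le> n"
  shows "d a < d b"
  using no_321[of k a b] d_less_last[of k a] d_inj[of a b] assms by force

text \<open>A descent before 2 avoids 1, which has index 0 and cannot start a descent, so 2 would
  complete it to a 321.\<close>

lemma less_before_two:
  assumes "1 \<le> a" "a \<le> n" "1 \<le> b" "b \<le> n" "d a < d b" "d b < d 2"
  shows "a < b"
proof (rule ccontr)
  assume "\<not> a < b"
  then have "b < a" using assms by (cases "a = b") auto
  moreover have "b \<noteq> 1" "b \<noteq> 2" using assms d_1 by auto
  ultimately show False using no_321[of 2 b a] assms by auto
qed

text \<open>The entry \<open>n\<close> in front of a descent would give a 321.\<close>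

lemma less_after_n:
  assumes "1 \<le> a" "a \<le> n" "1 \<le> b" "b \<le> n" "d n < d a" "d a < d b"
  shows "a < b"
proof (rule ccontr)
  assume "\<not> a < b"
  then have "b < a" using assms by (cases "a = b") auto
  moreover have "a \<noteq> n" using assms by auto
  ultimately show False using no_321[of b a n] assms by auto
qed

text \<open>\<open>\<pi> 1\<close> has index 1, so it starts the increasing run of entries between 1
  and 2.\<close>

lemma first_le_before_two:
  assumes "1 \<le> y" "y \<le> n" "y \<noteq> 1" "d y < d 2"
  shows "\<pi> 1 \<le> y"
proof -
  have "0 < d y" using d_pos assms by auto
  show ?thesis
  proof (cases "\<pi> 1 = y")
    case False
    have "\<pi> 1 \<noteq> 1" using no_fixpoint[of 1] assms by auto
    then have "d (\<pi> 1) = 1" using d_step[of 1] d_1 n_pos by auto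
    moreover have "d (\<pi> 1) \<noteq> d y" using d_inj[of "\<pi> 1" y] False ran[of 1] assms by auto
    ultimately have "d (\<pi> 1) < d y" using \<open>0 < d y\<close> by auto
    then show ?thesis using less_before_two[of "\<pi> 1" y] ran[of 1] assms by auto
  qed simp
qed

text \<open>The value \<open>n\<close> at position \<open>t\<close> serves as the 3 of a
  132.\<close>

lemma around_n:
  assumes "1 \<le> t" "\<pi> t = n" "1 \<le> i" "i < t" "t < l" "l \<le> n"
  shows "\<pi> l < \<pi> i"
proof -
  have "\<pi> l \<noteq> n" "\<pi> l \<noteq> \<pi> i" using inj assms by (metis less_irrefl, metis less_irrefl less_trans)
  then show ?thesis using no_132[of i t l] ran[of l] assms by force
qed

text \<open>The value 1 at position \<open>k\<close> serves as the 1 of a 132.\<close>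

lemma mono_after_last:
  assumes "1 \<le> k" "\<pi> k = 1" "k < i" "i < j" "j \<le> n"
  shows "\<pi> i < \<pi> j"
proof -
  have "\<pi> j \<noteq> 1" "\<pi> i \<noteq> \<pi> j" using inj assms by (metis less_irrefl less_trans, metis less_irrefl)
  then show ?thesis using no_132[of k i j] ran[of j] assms by force
qed

text \<open>Suppose \<open>v = \<pi> p < b = \<pi> n\<close>, and let \<open>\<pi> t = n\<close> and \<open>\<pi> w = 2\<close>. If \<open>w < k\<close>, then \<open>b = t + 1\<close> and
  the \<open>t\<close> values in \<open>{1, 3, \<dots>, b}\<close> all lie in the \<open>n - w < t\<close> positions after \<open>w\<close>. If \<open>w > k\<close>, then
  \<open>w = k + 1\<close>, and \<open>k + 1, v, t\<close> forms a 321 in the cycle notation unless \<open>k + 1, v, p\<close> or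
  \<open>k + 1, t, b\<close> does.\<close>

lemma before_last_greater:
  assumes k: "1 \<le> k" "\<pi> k = 1" and "1 \<le> p" "p < k" "k < q" "q \<le> n"
  shows "\<pi> q < \<pi> p"
proof (rule ccontr)
  assume "\<not> \<pi> q < \<pi> p"
  moreover have "\<pi> q \<noteq> \<pi> p" using inj[of q p] assms by auto
  ultimately have "\<pi> p < \<pi> q" by simp
  define b where "b = \<pi> n"
  define v where "v = \<pi> p"
  have "\<pi> q \<le> b" unfolding b_def using mono_after_last[of k q n] assms by (cases "q = n") auto
  then have vb: "v < b" using \<open>\<pi> p < \<pi> q\<close> v_def by simp
  have n2: "2 \<le> n" "k < n" "p \<le> n" "k \<le> n" using assms by auto
  have v1: "1 < v" "v \<le> n" using ran[of p] inj[of p k] assms v_def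
    by (metis One_nat_def le_neq_implies_less less_irrefl n2(3) k(2), use ran[of p] assms n2 v_def in auto)
  have b: "b \<le> n" "2 < b" "b \<noteq> n" using ran[of n] n2 no_fixpoint[of n] vb v1 by (auto simp: b_def)
  obtain t where t: "1 \<le> t" "t \<le> n" "\<pi> t = n" using preimage[of n] n2 by auto
  obtain w where w: "1 \<le> w" "w \<le> n" "\<pi> w = 2" using preimage[of 2] n2 by auto
  have tn: "t \<noteq> n" "t \<noteq> k" using no_fixpoint[of n] t n2 k by auto
  have pos_t: "t < x" if "1 \<le> x" "x \<le> n" "\<pi> x < b" for x
  proof (rule ccontr)
    assume "\<not> t < x"
    moreover have "x \<noteq> t" using that t b by auto
    ultimately show False using around_n[of t x n] t tn that b_def by auto
  qed
  have tp: "t < p" and tw: "t < w"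
    using pos_t[of p] pos_t[of w] w assms vb v_def b by auto
  have db: "d b = Suc (d n)" using d_step[of n] b n2 by (auto simp: b_def)
  have dt: "d n = Suc (d t)" using d_step[of t] t n2 by auto
  have d2: "d 2 = Suc (d w)" using d_step[of w] w by auto
  have dv: "d v = Suc (d p)" using d_step[of p] assms v1 n2 by (auto simp: v_def)
  have wk: "w \<noteq> k" "w \<noteq> t" using w k t b by auto
  have wn: "w \<noteq> n" using w b b_def by auto
  \<comment> \<open>\<open>b\<close> directly follows \<open>n\<close> in the cycle and the entries
    after \<open>n\<close> increase, so smaller entries come before \<open>n\<close>.\<close>
  have before_n: "d y < d n" if "1 \<le> y" "y < b" for y
  proof (rule ccontr)
    assume "\<not> d y < d n"
    moreover have "d y \<noteq> d n" using d_inj[of y n] that b by auto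
    moreover have "d y \<noteq> d b" using d_inj[of y b] that b by auto
    ultimately have "d b < d y" using db by auto
    then have "b < y" using less_after_n[of b y] db that b by auto
    then show False using that by simp
  qed
  have b1: "b < \<pi> 1" if "t \<noteq> 1"
    using around_n[of t 1 n] that t tn by (auto simp: b_def)
  have tb: "t \<noteq> b" using dt db by auto
  show False
  proof (cases "w < k")
    case True
    have d2n: "d 2 < d n"
    proof (rule ccontr)
      assume "\<not> d 2 < d n"
      moreover have "d n \<noteq> d w" using d_inj[of n w] w wn n2 by auto
      moreover have "d 2 \<noteq> d n" using d_inj[of 2 n] n2 b by auto
      ultimately have "d n < d w" "d w < d 2" using d2 by auto
      then show False using less_before_two[of n w] w n2 by auto
    qed
    then have d2t: "d 2 \<le> d t" using dt by auto
    then have "t \<noteq> 1" using d2 d_1 by auto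
    note b1 = b1[OF this]
    have "w \<noteq> 1" using w b1 b by auto
    then have w1: "\<pi> 1 \<le> w" using first_le_before_two[of w] w d2 by auto
    \<comment> \<open>Otherwise \<open>w\<close>, \<open>t\<close>, \<open>b\<close>, met in this
      order on the cycle, would decrease.\<close>
    have t_less_b: "t < b"
      using no_321[of b t w] d2t d2 dt db tb tw t b w by fastforce
    have bt: "b = Suc t"
    proof (rule ccontr)
      assume "b \<noteq> Suc t"
      \<comment> \<open>If there is a gap between \<open>t\<close> and \<open>b\<close>, then
        \<open>w\<close>, \<open>y\<close>, \<open>t\<close> is a 321 in the cycle.\<close>
      define y where "y = b - 1"
      have y: "t < y" "y < b" "1 < y" "y \<le> n" using y_def t_less_b \<open>b \<noteq> Suc t\<close> b by auto
      have "d y \<noteq> d t" using d_inj[of y t] y t by auto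
      then have yt: "d y < d t" using before_n[of y] y dt by auto
      have "d y \<noteq> d w" using d_inj[of y w] y w w1 b1 by auto
      moreover have "\<not> d y < d w" using first_le_before_two[of y] y d2 b1 by auto
      ultimately have "d w < d y" by simp
      then show False using no_321[of t y w] yt y t w w1 b1 by auto
    qed
    \<comment> \<open>For \<open>x < w\<close>, the entries \<open>w\<close>, \<open>x\<close>,
      \<open>\<pi> x\<close> come in this order on the cycle, so
      \<open>x < \<pi> x \<le> t + 1\<close>; thus \<open>x < t\<close>, and \<open>around_n\<close>
      makes \<open>\<pi> x\<close> exceed \<open>b\<close>.\<close>
    have pos_w: "w < x" if x: "1 \<le> x" "x \<le> n" "2 < \<pi> x" "\<pi> x \<le> b" for x
    proof (rule ccontr)
      assume "\<not> w < x"
      then have xw: "x < w" using x w by (cases "x = w") auto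
      have dx: "d (\<pi> x) = Suc (d x)" using d_step[of x] x by auto
      have "d w \<noteq> d x" using d_inj[of w x] x w xw by auto
      moreover have "\<not> d x < d w"
      proof
        assume "d x < d w"
        then have "d (\<pi> x) < d 2" using dx d2 by auto
        then have "\<pi> 1 \<le> \<pi> x" using first_le_before_two[of "\<pi> x"] x ran[of x] by auto
        then show False using b1 x by auto
      qed
      ultimately have "d w < d x" by simp
      then have "\<not> \<pi> x < x" using no_321[of "\<pi> x" x w] dx x ran[of x] xw w by auto
      then have "x < \<pi> x" using no_fixpoint[of x] x n2 by auto
      then have "x \<le> t" using x bt by auto
      moreover have "x \<noteq> t" using x t b by auto
      ultimately have "b < \<pi> x" using around_n[of t x n] x t tn b_def by auto
      then show False using x by simp
    qed
    have "card (insert 1 {3..b}) \<le> card {Suc w..n}"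
    proof (rule surj_card_le)
      show "insert 1 {3..b} \<subseteq> \<pi> ` {Suc w..n}"
      proof
        fix y assume y: "y \<in> insert 1 {3..b}"
        then have "1 \<le> y" "y \<le> n" using b n2 by auto
        then obtain x where x: "1 \<le> x" "x \<le> n" "\<pi> x = y" by (rule preimage)
        have "w < x"
        proof (cases "y = 1")
          case True
          then have "x = k" using x k inj by metis
          then show ?thesis using \<open>w < k\<close> by simp
        qed (use pos_w[of x] x y in auto)
        then show "y \<in> \<pi> ` {Suc w..n}" using x by force
      qed
    qed simp
    then have c1: "b - 1 \<le> n - w" using b by (simp add: card_insert_if)
    \<comment> \<open>All positions after \<open>t\<close> carry values below
      \<open>\<pi> 1 \<le> w\<close>, which yields \<open>n - w < t\<close>.\<close>
    have "card {Suc t..n} \<le> card {1..<\<pi> 1}"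
    proof (rule card_inj_on_le)
      show "inj_on \<pi> {Suc t..n}" by (auto intro: inj_onI inj)
      show "\<pi> ` {Suc t..n} \<subseteq> {1..<\<pi> 1}"
        using around_n[of t 1] ran t \<open>t \<noteq> 1\<close> by auto
    qed simp
    then have "n - t \<le> \<pi> 1 - 1" by simp
    then show False using c1 w1 bt w b b1 by linarith
  next
    case False
    then have "k < w" using wk by simp
    have wk1: "w = Suc k"
    proof (rule ccontr)
      assume "w \<noteq> Suc k"
      then have "\<pi> (Suc k) < 2" using mono_after_last[of k "Suc k" w] k w \<open>k < w\<close> by auto
      moreover have "\<pi> (Suc k) \<noteq> \<pi> k" using inj by (metis n_not_Suc_n)
      ultimately show False using ran[of "Suc k"] k n2 by auto
    qed
    have "w < n" using wn w by auto
    have dwn: "d w < d n" using less_above_last[of k w n] k \<open>k < w\<close> \<open>w < n\<close> by auto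
    have "d 2 \<noteq> d n" using d_inj[of 2 n] n2 b by auto
    then have d2t: "d 2 < d n" "d 2 \<le> d t" using dwn d2 dt by auto
    then have "t \<noteq> 1" using d2 d_1 by auto
    note b1 = b1[OF this]
    have t_less_b: "t < b"
      using no_321[of b t w] d2t d2 dt db tb tw t b w by fastforce
    \<comment> \<open>Otherwise \<open>v\<close> precedes 2, so \<open>\<pi> 1 \<le> v < b\<close>,
      against \<open>b1\<close>.\<close>
    have dwp: "d w < d p"
    proof (rule ccontr)
      assume "\<not> d w < d p"
      moreover have "d w \<noteq> d p" using d_inj[of w p] w assms n2 wk1 by auto
      ultimately have "d v < d 2" using dv d2 by auto
      then show False using first_le_before_two[of v] v1 vb b1 by auto
    qed
    \<comment> \<open>Entries above \<open>k\<close> increase along the cycle, yet \<open>b\<close>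
      comes after \<open>n\<close>.\<close>
    have bk: "b \<le> k"
    proof (rule ccontr)
      assume "\<not> b \<le> k"
      then have "d b < d n" using less_above_last[of k b n] k b by auto
      then show False using db by simp
    qed
    \<comment> \<open>The forbidden triple is \<open>w\<close>, \<open>p\<close>, \<open>v\<close>,
      where \<open>w = k + 1\<close> and \<open>v\<close> directly follows \<open>p\<close>.\<close>
    have "\<not> v < p" using no_321[of v p w] dwp dv v1 wk1 w assms by auto
    then have "p < v" using no_fixpoint[of p] assms n2 v_def by (metis nat_neq_iff)
    moreover have "d v \<noteq> d t" using d_inj[of v t] v1 t tp \<open>p < v\<close> by auto
    then have "d v < d t" using before_n[of v] v1 vb dt by auto
    ultimately show False using no_321[of t v w] t tp vb bk wk1 w dwp dv by auto
  qed
qed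

text \<open>If a value were skipped right of \<open>k\<close>, it could stand neither left of
  \<open>k\<close>, where values exceed all those to the right, nor elsewhere right of
  \<open>k\<close>, where values increase.\<close>

lemma block_after_last:
  assumes k: "1 \<le> k" "\<pi> k = 1" and "k + i \<le> n"
  shows "\<pi> (k + i) = Suc i"
  using assms(3)
proof (induction i)
  case 0
  then show ?case using k by simp
next
  case (Suc i)
  then have IH: "\<pi> (k + i) = Suc i" by simp
  have "\<pi> (k + i) < \<pi> (k + Suc i)"
    using mono_after_last[of k "k + i" "k + Suc i"] k Suc.prems ran[of "k + Suc i"]
      inj[of "k + Suc i" k] by (cases i) force+
  then have ge: "Suc (Suc i) \<le> \<pi> (k + Suc i)" using IH by simp
  show ?case
  proof (rule ccontr)
    assume "\<pi> (k + Suc i) \<noteq> Suc (Suc i)"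
    then have gt: "Suc (Suc i) < \<pi> (k + Suc i)" using ge by simp
    then obtain x where x: "1 \<le> x" "x \<le> n" "\<pi> x = Suc (Suc i)"
      using preimage[of "Suc (Suc i)"] ran[of "k + Suc i"] Suc.prems by auto
    have "\<not> x < k" using before_last_greater[of k x "k + Suc i"] k x gt Suc.prems by auto
    moreover have "x \<noteq> k" "x \<noteq> k + i" "x \<noteq> k + Suc i" using x k IH gt by auto
    moreover have "\<not> (k < x \<and> x < k + i)"
      using mono_after_last[of k x "k + i"] k x IH Suc.prems by auto
    moreover have "\<not> k + Suc i < x"
      using mono_after_last[of k "k + Suc i" x] k x gt by auto
    ultimately show False by linarith
  qed
qed

end

subsection \<open>The avoiders with 1 not in the last position\<close>

text \<open>The cycle notation of \<open>riffle n m\<close> is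
  \<open>1, k + 1, 2, k + 2, \<dots>, m, n, m + 1, m + 2, \<dots>, k\<close> with \<open>k = n - m\<close>.\<close>

definition riffle :: "nat \<Rightarrow> nat \<Rightarrow> nat \<Rightarrow> nat" where
  "riffle n m y =
     (if y = 0 \<or> n < y then y else if y \<le> m then n - m + y
      else if y < n - m then Suc y else Suc y - (n - m))"

text \<open>The cycle notation of \<open>leap n x\<close> is
  \<open>1, x, x + 2, \<dots>, n, 2, 3, \<dots>, x - 1, x + 1, x + 3, \<dots>, n - 1\<close>, provided that \<open>n - x\<close> is even.\<close>

definition leap :: "nat \<Rightarrow> nat \<Rightarrow> nat \<Rightarrow> nat" where
  "leap n x y =
     (if y = 0 \<or> n < y then y else if y = 1 then x else if y + 2 \<le> x then Suc y
      else if y + 2 \<le> n then y + 2 else y + 2 - n)"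

context avoider
begin

text \<open>The value \<open>Suc i\<close> is taken no later than at \<open>i\<close>, since values
  exceed positions, and by induction the earlier positions of the window take smaller values. Both
  families below contain such a run.\<close>

lemma eq_Suc_if_increasing:
  assumes incr: "\<And>i. \<lbrakk>l \<le> i; i < h\<rbrakk> \<Longrightarrow> i < \<pi> i"
    and pre: "\<And>x. \<lbrakk>1 \<le> x; x \<le> n; l < \<pi> x; \<pi> x \<le> h\<rbrakk> \<Longrightarrow> l \<le> x \<and> x < h"
    and h: "h \<le> n" and i: "l \<le> i" "i < h"
  shows "\<pi> i = Suc i"
  using i
proof (induction i rule: less_induct)
  case (less i)
  obtain x where x: "1 \<le> x" "x \<le> n" "\<pi> x = Suc i"
    using preimage[of "Suc i"] less.prems h by auto
  then have lx: "l \<le> x" "x < h" using pre[of x] less.prems by auto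
  then have "x \<le> i" using incr[of x] x by auto
  moreover have "\<not> x < i" using less.IH[of x] lx x by auto
  ultimately show ?case using x by auto
qed

lemma last_ge_2: "2 \<le> n \<Longrightarrow> 1 \<le> k \<Longrightarrow> \<pi> k = 1 \<Longrightarrow> 2 \<le> k"
  using no_fixpoint[of 1] by (cases "k = 1") auto

text \<open>Each \<open>i + 1\<close> with \<open>1 \<le> i \<le> m\<close> directly follows
  \<open>k + i\<close>, and the entries above \<open>k\<close> increase along the cycle. This forces
  the alternating start of the cycle; the remaining entries then have to increase.\<close>

lemma eq_riffle:
  assumes k: "1 \<le> k" "\<pi> k = 1" and n: "n = k + m" and m: "2 \<le> m"
  shows "2 * m + 1 \<le> n \<and> \<pi> = riffle n m"
proof -
  have k2: "2 \<le> k" using last_ge_2[of k] k n m by auto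
  have blk: "\<pi> (k + i) = Suc i" if "i \<le> m" for i
    using block_after_last[of k i] k n that by auto
  have dblk: "d (Suc i) = Suc (d (k + i))" if "1 \<le> i" "i \<le> m" for i
    using d_step[of "k + i"] blk[OF that(2)] n that k by auto
  have dinc: "d a < d b" if "k < a" "a < b" "b \<le> n" for a b
    using less_above_last[of k a b] that k by auto
  \<comment> \<open>If \<open>k \<le> m\<close>, then \<open>k + 1\<close> would directly follow the
    larger entry \<open>2 * k\<close>.\<close>
  have km: "Suc m \<le> k"
  proof (rule ccontr)
    assume "\<not> Suc m \<le> k"
    then have "k \<le> m" by simp
    then show False using dblk[of k] dinc[of "Suc k" "k + k"] k2 n by auto
  qed
  have low: "Suc (Suc m) \<le> \<pi> x" if x: "1 \<le> x" "x < k" for x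
  proof (rule ccontr)
    assume "\<not> Suc (Suc m) \<le> \<pi> x"
    then have "\<pi> (k + (\<pi> x - 1)) = \<pi> x" using blk[of "\<pi> x - 1"] ran[of x] x n by auto
    then have "k + (\<pi> x - 1) = x" by (rule inj)
    then show False using x by simp
  qed
  have dm: "d (Suc m) = Suc (d n)" using dblk[of m] m n by auto
  have d2: "d 2 = Suc (d (Suc k))" using dblk[of 1] m by (simp add: numeral_2_eq_2)
  \<comment> \<open>If \<open>\<pi> i \<le> k\<close>, then \<open>k + 1\<close>,
    \<open>\<pi> i\<close>, \<open>m + 1\<close> is a 321 in the cycle, because \<open>m + 1\<close>
    directly follows \<open>n\<close>.\<close>
  have large: "k < \<pi> i" if i: "2 \<le> i" "i \<le> m" for i
  proof (rule ccontr)
    assume "\<not> k < \<pi> i"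
    then have yk: "\<pi> i \<le> k" by simp
    have di: "d i = Suc (d (k + i - 1))" using dblk[of "i - 1"] i by auto
    have dy: "d (\<pi> i) = Suc (d i)" using d_step[of i] low[of i] i km n by auto
    have "d (k + i - 1) < d n" using dinc[of "k + i - 1" n] i n by auto
    moreover have "d i \<noteq> d n" using d_inj[of i n] i n k by auto
    moreover have "d (\<pi> i) \<noteq> d n" using d_inj[of "\<pi> i" n] ran[of i] yk i n m by auto
    ultimately have "d (\<pi> i) < d n" using di dy by auto
    moreover have le: "k + i - 1 \<le> n" using i n by linarith
    have "Suc k = k + i - 1 \<or> Suc k < k + i - 1" using i by linarith
    then have "d (Suc k) \<le> d (k + i - 1)" using dinc[of "Suc k" "k + i - 1"] le i n by fastforce
    ultimately show False
      using no_321[of "Suc m" "\<pi> i" "Suc k"] low[of i] i km n m yk di dy dm by auto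
  qed
  \<comment> \<open>If \<open>\<pi> 1 \<le> k\<close>, the value \<open>k + 1\<close> stands right
    of position 2, and positions 1, 2, \<open>p\<close> form a 132.\<close>
  have first: "k < \<pi> 1"
  proof (rule ccontr)
    assume "\<not> k < \<pi> 1"
    obtain p where p: "1 \<le> p" "p \<le> n" "\<pi> p = Suc k" using preimage[of "Suc k"] n m by auto
    have "p \<noteq> 1" using p \<open>\<not> k < \<pi> 1\<close> by auto
    moreover have "p \<noteq> 2" using d_step[of p] p d2 k by auto
    ultimately have p2: "2 < p" using p by auto
    have "\<pi> 2 \<noteq> \<pi> p" using inj[of 2 p] p2 by auto
    then have "Suc k < \<pi> 2" using large[of 2] m p by auto
    then show False using no_132[of 1 2 p] p p2 \<open>\<not> k < \<pi> 1\<close> by auto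
  qed
  \<comment> \<open>For \<open>i \<ge> 2\<close> only \<open>i\<close> separates
    \<open>k + i - 1\<close> from \<open>\<pi> i\<close> on the cycle, so by monotonicity above
    \<open>k\<close> there is no room for a skipped \<open>k + i\<close>. For \<open>i = 1\<close>
    nothing but 1 precedes \<open>\<pi> 1\<close>.\<close>
  have start: "\<pi> i = k + i" if i: "1 \<le> i" "i \<le> m" for i
  proof -
    have yk: "k < \<pi> i" using large[of i] first i by (cases "i = 1") auto
    have yn: "\<pi> i \<le> n" using ran[of i] i n by auto
    have dy: "d (\<pi> i) = Suc (d i)" using d_step[of i] yk k i n by auto
    have di: "i = 1 \<and> d i = 0 \<or> 2 \<le> i \<and> d i = Suc (d (k + i - 1))"
      using dblk[of "i - 1"] d_1 i by (cases "i = 1") auto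
    have "\<not> \<pi> i < k + i"
    proof
      assume "\<pi> i < k + i"
      then have "2 \<le> i" "\<pi> i \<le> k + i - 1" using yk i by auto
      moreover have "k + i - 1 \<le> n" using i n by linarith
      ultimately have "d (\<pi> i) \<le> d (k + i - 1)"
        using dinc[of "\<pi> i" "k + i - 1"] yk by (cases "\<pi> i = k + i - 1") fastforce+
      then show False using di \<open>2 \<le> i\<close> dy by auto
    qed
    moreover have "\<not> k + i < \<pi> i"
    proof
      assume "k + i < \<pi> i"
      then have "d (k + i) < Suc (d i)" using dinc[of "k + i" "\<pi> i"] yn i dy by auto
      moreover have "d (k + i) \<noteq> d i" using d_inj[of "k + i" i] i n k by auto
      moreover have "d (k + i - 1) < d (k + i)" if "2 \<le> i"
        using dinc[of "k + i - 1" "k + i"] i n that by auto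
      ultimately show False using di by auto
    qed
    ultimately show ?thesis by simp
  qed
  have d_first: "d (Suc k) = 1" using d_step[of 1] start[of 1] d_1 m n k by auto
  \<comment> \<open>A descent from \<open>i\<close> to \<open>\<pi> i\<close> after \<open>n\<close>
    gives the 321 \<open>n\<close>, \<open>i\<close>, \<open>\<pi> i\<close>; before
    \<open>n\<close>, the triple \<open>k + 1\<close>, \<open>i\<close>, \<open>m + 1\<close> is
    one.\<close>
  have mid: "i < \<pi> i" if i: "Suc m \<le> i" "i < k" for i
  proof (rule ccontr)
    assume "\<not> i < \<pi> i"
    then have y: "\<pi> i < i" using no_fixpoint[of i] i n k m by auto
    have dy: "d (\<pi> i) = Suc (d i)" using d_step[of i] low[of i] i n by auto
    show False
    proof (cases "d n < d i")
      case True
      then show False using no_321[of "\<pi> i" i n] y i n dy low[of i] by auto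
    next
      case False
      have "d i \<noteq> d n" using d_inj[of i n] i n k by auto
      then have din: "d i < d n" using False by simp
      then have "i \<noteq> Suc m" using dm by auto
      moreover have "0 < d i" using d_pos[of i] i n m by auto
      moreover have "d i \<noteq> d (Suc k)" using d_inj[of i "Suc k"] i n m by auto
      ultimately show False using no_321[of "Suc m" i "Suc k"] i n m d_first din dm by auto
    qed
  qed
  have mid_eq: "\<pi> i = Suc i" if "Suc m \<le> i" "i < k" for i
  proof (rule eq_Suc_if_increasing[OF mid _ _ that])
    fix x assume x: "1 \<le> x" "x \<le> n" "Suc m < \<pi> x" "\<pi> x \<le> k"
    have "\<not> x \<le> m" using start[of x] x by auto
    moreover have "x - k \<le> m" using x n by linarith
    then have "\<not> k \<le> x" using blk[of "x - k"] x by auto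
    ultimately show "Suc m \<le> x \<and> x < k" by auto
  qed (use n in auto)
  have "\<pi> y = riffle n m y" for y
  proof -
    consider "y = 0 \<or> n < y" | "1 \<le> y" "y \<le> m" | "Suc m \<le> y" "y < k" | "k \<le> y" "y \<le> n"
      by linarith
    then show ?thesis
    proof cases
      case 1
      then have "\<pi> y = y" using permutes_not_in[OF perm, of y] by auto
      then show ?thesis using 1 by (simp add: riffle_def)
    next
      case 4
      then have "\<pi> y = Suc (y - k)" using blk[of "y - k"] n by auto
      then show ?thesis using 4 n km k by (auto simp: riffle_def)
    qed (use start mid_eq n in \<open>auto simp: riffle_def\<close>)
  qed
  then show ?thesis using km n by auto
qed

text \<open>With \<open>x = \<pi> 1\<close>, the values below \<open>x\<close> form a run of
  successors, and the values above \<open>x\<close> increase and exactly fill their positions. Only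
  parity then decides whether the result is a single cycle.\<close>

lemma eq_leap:
  assumes n: "3 \<le> n" "n = Suc k" and k: "\<pi> k = 1"
  shows "\<exists>x. 3 \<le> x \<and> x \<le> n \<and> even (n - x) \<and> \<pi> = leap n x"
proof -
  have pn: "\<pi> n = 2" using block_after_last[of k 1] n k by auto
  define x where "x = \<pi> 1"
  have x3: "3 \<le> \<pi> i" if "1 \<le> i" "i < k" for i
  proof -
    have "\<pi> i \<noteq> 1" "\<pi> i \<noteq> 2" using inj[of i k] inj[of i n] k pn that n by auto
    then show ?thesis using ran[of i] that n by auto
  qed
  then have x: "3 \<le> x" "x \<le> n" using ran[of 1] n by (auto simp: x_def)
  have d2: "d 2 = Suc (d n)" using d_step[of n] pn n by auto
  \<comment> \<open>A descent from \<open>i\<close> to \<open>\<pi> i\<close> is completed to a 321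
    by \<open>n\<close> in front of it or by 2, the successor of \<open>n\<close>, behind
    it.\<close>
  have incr: "i < \<pi> i" if i: "2 \<le> i" "i + 2 \<le> n" for i
  proof (rule ccontr)
    assume "\<not> i < \<pi> i"
    then have y: "\<pi> i < i" using no_fixpoint[of i] i by auto
    have y3: "3 \<le> \<pi> i" using x3[of i] i n by auto
    have dy: "d (\<pi> i) = Suc (d i)" using d_step[of i] y3 i by auto
    show False
    proof (cases "d n < d i")
      case True
      then show False using no_321[of "\<pi> i" i n] y y3 i dy by auto
    next
      case False
      have "d i \<noteq> d n" "d (\<pi> i) \<noteq> d n"
        using d_inj[of i n] d_inj[of "\<pi> i" n] i y y3 by auto
      then show False using no_321[of 2 "\<pi> i" i] y y3 i dy d2 False by auto
    qed
  qed
  have mid: "\<pi> i = Suc i" if "2 \<le> i" "i < x - 1" for i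
  proof (rule eq_Suc_if_increasing[OF incr _ _ that])
    fix z assume z: "1 \<le> z" "z \<le> n" "2 < \<pi> z" "\<pi> z \<le> x - 1"
    have "z \<noteq> 1" "z \<noteq> k" "z \<noteq> n" using z x k pn by (auto simp: x_def)
    then show "2 \<le> z \<and> z < x - 1" using incr[of z] z n by auto
  qed (use x in auto)
  have gt: "x < \<pi> i" if i: "x - 1 \<le> i" "i + 2 \<le> n" for i
  proof (rule ccontr)
    assume "\<not> x < \<pi> i"
    moreover have "\<pi> i \<noteq> x" using inj[of i 1] i x by (auto simp: x_def)
    moreover have ge: "3 \<le> \<pi> i" using x3[of i] i x n by auto
    ultimately have "\<pi> (\<pi> i - 1) = \<pi> i" "\<pi> i < x" using mid[of "\<pi> i - 1"] by auto
    then have "\<pi> i - 1 = i" "\<pi> i < x" using inj[of "\<pi> i - 1" i] by auto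
    then show False using i ge by linarith
  qed
  have x1: "1 < x - 1" using x by linarith
  \<comment> \<open>Position 1 with value \<open>x\<close> serves as the 1 of a 132, so these larger
    values increase.\<close>
  have step: "\<pi> i + j \<le> \<pi> (i + j)" if "x - 1 \<le> i" "i + j + 2 \<le> n" for i j
    using that
  proof (induction j)
    case (Suc j)
    have "\<pi> (i + j) \<noteq> \<pi> (i + Suc j)" using inj[of "i + j" "i + Suc j"] by auto
    then have "\<pi> (i + j) < \<pi> (i + Suc j)"
      using no_132[of 1 "i + j" "i + Suc j"] gt[of "i + Suc j"] Suc.prems x1
      by (fastforce simp: x_def)
    then show ?case using Suc by auto
  qed simp
  \<comment> \<open>There are \<open>n - x\<close> positions from \<open>x - 1\<close> to
    \<open>n - 2\<close> and \<open>n - x\<close> values above \<open>x\<close>; the two bounds from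
    \<open>step\<close> meet.\<close>
  have end_eq: "\<pi> i = i + 2" if i: "x - 1 \<le> i" "i + 2 \<le> n" for i
  proof -
    have "i + (n - 2 - i) = n - 2" "n - 2 + 2 \<le> n" "1 \<le> n - 2" using i x n by linarith+
    then have "\<pi> i + (n - 2 - i) \<le> n" using step[of i "n - 2 - i"] i ran[of "n - 2"] by simp
    moreover have "x - 1 + (i - (x - 1)) = i" using i by linarith
    then have "\<pi> (x - 1) + (i - (x - 1)) \<le> \<pi> i" using step[of "x - 1" "i - (x - 1)"] i by simp
    moreover have "x < \<pi> (x - 1)" using gt[of "x - 1"] i by auto
    ultimately show ?thesis using i x by auto
  qed
  have "even (n - x)"
  proof (rule ccontr)
    assume odd: "odd (n - x)"
    \<comment> \<open>For odd \<open>n - x\<close> the orbit of 1 runs through \<open>x\<close>,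
      \<open>x + 2\<close>, ..., \<open>n - 1\<close> and back to 1, so it misses
      \<open>n\<close>.\<close>
    have "(\<pi> ^^ j) 1 = 1 \<or> x \<le> (\<pi> ^^ j) 1 \<and> (\<pi> ^^ j) 1 < n \<and> even ((\<pi> ^^ j) 1 - x)" for j
    proof (induction j)
      case (Suc j)
      define y where "y = (\<pi> ^^ j) 1"
      have y: "y = 1 \<or> x \<le> y \<and> y < n \<and> even (y - x)" using Suc by (simp add: y_def)
      have "\<pi> y = 1 \<or> x \<le> \<pi> y \<and> \<pi> y < n \<and> even (\<pi> y - x)"
      proof (cases "y = 1")
        case True
        then show ?thesis using odd x by (cases "x = n") (auto simp: x_def)
      next
        case False
        then have y: "x \<le> y" "y < n" "even (y - x)" using y by auto
        show ?thesis
        proof (cases "y = k")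
          case False
          then have "\<pi> y = y + 2" using end_eq[of y] y n by auto
          moreover have "y + 2 \<noteq> n" using y odd by (auto simp: even_diff_nat)
          ultimately show ?thesis using y False n by (auto simp: even_diff_nat)
        qed (use k in simp)
      qed
      then show ?case by (simp add: y_def)
    qed simp
    from this[of "d n"] show False using funpow_d[of n] n by auto
  qed
  moreover have "\<pi> y = leap n x y" for y
  proof -
    consider "y = 0 \<or> n < y" | "y = 1" | "2 \<le> y" "y < x - 1" | "x - 1 \<le> y" "2 \<le> y" "y + 2 \<le> n"
      | "y = k" | "y = n" using n by linarith
    then show ?thesis
    proof cases
      case 1
      then have "\<pi> y = y" using permutes_not_in[OF perm, of y] by auto
      then show ?thesis using 1 by (simp add: leap_def)
    next
      case 2
      then show ?thesis using n by (simp add: leap_def x_def)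
    next
      case 3
      then have "y + 2 \<le> x" by linarith
      then show ?thesis using 3 mid[of y] x by (simp add: leap_def)
    next
      case 4
      then show ?thesis using end_eq[of y] x by (simp add: leap_def)
    next
      case 5
      then show ?thesis using k n x by (simp add: leap_def)
    next
      case 6
      then show ?thesis using pn n x by (simp add: leap_def)
    qed
  qed
  ultimately show ?thesis using x by blast
qed

end

section \<open>Both families consist of avoiders\<close>

lemma permutes_atLeastAtMostI:
  fixes f :: "nat \<Rightarrow> nat"
  assumes "\<And>y. 1 \<le> y \<Longrightarrow> y \<le> n \<Longrightarrow> 1 \<le> f y \<and> f y \<le> n"
    and "\<And>y. y = 0 \<or> n < y \<Longrightarrow> f y = y"
    and "\<And>x y. \<lbrakk>1 \<le> x; x \<le> n; 1 \<le> y; y \<le> n; f x = f y\<rbrakk> \<Longrightarrow> x = y"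
  shows "f permutes {1..n}"
proof (rule bij_imp_permutes)
  have inj: "inj_on f {1..n}" using assms(3) by (auto intro!: inj_onI)
  have "f ` {1..n} = {1..n}"
    using assms(1) by (intro endo_inj_surj inj) auto
  then show "bij_betw f {1..n} {1..n}" using inj by (simp add: bij_betw_def)
qed (use assms(2) in auto)

text \<open>By pigeonhole, two entries of a 321 would lie in the same class of
  \<open>P\<close>.\<close>

lemma no_321_if_two_increasing:
  fixes d :: "nat \<Rightarrow> nat" and P :: "nat \<Rightarrow> bool"
  assumes "\<And>x y. \<lbrakk>1 \<le> x; x < y; y \<le> n; P x = P y\<rbrakk> \<Longrightarrow> d x < d y"
    and "1 \<le> e" "e < b" "b < a" "a \<le> n" "d a < d b"
  shows "\<not> d b < d e"
proof -
  have "P e = P b \<or> P b = P a \<or> P e = P a" by blast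
  then show ?thesis
    using assms(1)[of e b] assms(1)[of b a] assms(1)[of e a] assms(2-) by (elim disjE) simp_all
qed

lemma avoider_riffle:
  assumes "1 \<le> m" "2 * m + 1 \<le> n"
  shows "\<exists>d. avoider n (riffle n m) d"
proof -
  obtain k where n: "n = k + m" and k: "Suc m \<le> k"
    using assms by (intro that[of "n - m"]) auto
  \<comment> \<open>Indices read off the cycle: \<open>1..m + 1\<close> at even places,
    \<open>k + j\<close> at \<open>2 * j - 1\<close>, and the rest in order.\<close>
  define d where "d y = (if y \<le> Suc m then 2 * (y - 1) else if y \<le> k then y + m - 1
    else 2 * (y - k) - 1)" for y
  have r: "riffle (k + m) m y = (if y = 0 \<or> k + m < y then y else if y \<le> m then k + y
      else if y < k then Suc y else Suc y - k)" for y
    by (simp add: riffle_def)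
  have "avoider (k + m) (riffle (k + m) m) d"
  proof
    show "1 \<le> k + m" using k by simp
    show "riffle (k + m) m permutes {1..k + m}"
      by (rule permutes_atLeastAtMostI) (use k assms(1) in \<open>auto simp: r split: if_splits\<close>)
    show "d 1 = 0" by (simp add: d_def)
    show "d y < k + m" if "1 \<le> y" "y \<le> k + m" for y
      using that k assms(1) by (auto simp: d_def)
    show "d (riffle (k + m) m y) = Suc (d y)" if "1 \<le> y" "y \<le> k + m" "riffle (k + m) m y \<noteq> 1" for y
      using that k assms(1) by (auto simp: d_def r split: if_splits)
    show "\<not> riffle (k + m) m l < riffle (k + m) m j"
      if "1 \<le> i" "i < j" "j < l" "l \<le> k + m" "riffle (k + m) m i < riffle (k + m) m l" for i j l
      using that k assms(1) by (auto simp: r split: if_splits)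
    show "\<not> d b < d e" if "1 \<le> e" "e < b" "b < a" "a \<le> k + m" "d a < d b" for a b e
    proof (rule no_321_if_two_increasing[OF _ that])
      fix x y assume "1 \<le> x" "x < y" "y \<le> k + m" "(x \<le> k) = (y \<le> k)"
      then show "d x < d y" using k assms(1) by (auto simp: d_def)
    qed
  qed
  then show ?thesis unfolding n by blast
qed

lemma avoider_leap:
  assumes "3 \<le> x" "x \<le> n" "even (n - x)"
  shows "\<exists>d. avoider n (leap n x) d"
proof -
  obtain r where n: "n = x + 2 * r" using assms by (metis dvdE le_add_diff_inverse)
  \<comment> \<open>The entries \<open>1, x, x + 2, ..., n\<close> fill the indices 0 to
    \<open>r + 1\<close>; then come \<open>2..x - 1\<close>, and last
    \<open>x + 1, x + 3, ..., n - 1\<close>.\<close>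
  define d where "d y = (if y = 1 then 0 else if y < x then r + y
    else if even (y - x) then (y - x) div 2 + 1 else x + r + (y - x) div 2)" for y
  have ex: "\<exists>j. y = x + 2 * j \<or> y = x + 2 * j + 1" if "x \<le> y" for y
    using that by presburger
  have d_lo: "d y = r + y" if "2 \<le> y" "y < x" for y using that by (simp add: d_def)
  have d_even: "d (x + 2 * j) = Suc j" for j using assms by (simp add: d_def)
  have d_odd: "d (x + 2 * j + 1) = x + r + j" for j using assms by (simp add: d_def)
  have d_1: "d 1 = 0" by (simp add: d_def)
  have cases: "y = 1 \<or> 2 \<le> y \<and> y < x \<or> (\<exists>j. y = x + 2 * j) \<or> (\<exists>j. y = x + 2 * j + 1)"
    if "1 \<le> y" for y
    using ex[of y] that by (cases "y < x") auto
  have "avoider n (leap n x) d"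
  proof
    show "1 \<le> n" using assms by simp
    show "leap n x permutes {1..n}"
      by (rule permutes_atLeastAtMostI) (use assms in \<open>auto simp: leap_def split: if_splits\<close>)
    show "d 1 = 0" by (rule d_1)
    show "d y < n" if "1 \<le> y" "y \<le> n" for y
      using cases[OF that(1)] that n assms(1) by (auto simp: d_lo d_even d_odd[simplified] d_1[simplified])
    show "d (leap n x y) = Suc (d y)" if y: "1 \<le> y" "y \<le> n" "leap n x y \<noteq> 1" for y
    proof -
      consider "y = 1" | "2 \<le> y" "y + 2 \<le> x" | "y = x - 1" | j where "y = x + 2 * j"
        | j where "y = x + 2 * j + 1"
        using cases[OF y(1)] by force
      then show ?thesis
      proof cases
        case 1
        then show ?thesis using d_1 d_even[of 0] assms by (simp add: leap_def)
      next
        case 2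
        then show ?thesis using assms d_lo[of y] d_lo[of "Suc y"] by (simp add: leap_def)
      next
        case 3
        \<comment> \<open>For \<open>r = 0\<close> the entry \<open>x - 1 = n - 1\<close> ends the
          cycle and maps to 1, which is excluded here.\<close>
        have "r \<noteq> 0"
        proof
          assume "r = 0"
          then have "y \<noteq> 0" "y \<noteq> 1" "\<not> n < y" "\<not> y + 2 \<le> x" "\<not> y + 2 \<le> n" "y + 2 - n = 1"
            using 3 n assms(1) by linarith+
          then have "leap n x y = 1" unfolding leap_def by simp
          then show False using y by simp
        qed
        then have "leap n x y = x + 2 * 0 + 1" using 3 n assms(1) by (auto simp: leap_def)
        then show ?thesis using d_odd[of 0] d_lo[of y] 3 assms(1) by auto
      next
        case (4 j)
        show ?thesis
        proof (cases "j = r")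
          case True
          then have "leap n x y = 2" using 4 n assms(1) by (auto simp: leap_def)
          then show ?thesis using 4 True d_even d_lo[of 2] assms(1) by auto
        next
          case False
          then have "leap n x y = x + 2 * Suc j" using 4 y n assms(1) by (auto simp: leap_def)
          then show ?thesis unfolding 4 d_even by (simp only: d_even)
        qed
      next
        case (5 j)
        have "y + 2 \<noteq> n + 1" using y n assms(1) by (auto simp: leap_def split: if_splits)
        then have "y + 2 \<le> n" using 5 y(2) n by presburger
        then have "leap n x y = x + 2 * Suc j + 1" using 5 assms(1) by (auto simp: leap_def)
        then show ?thesis unfolding 5 by (simp only: d_odd)
      qed
    qed
    show "\<not> leap n x l < leap n x j"
      if "1 \<le> i" "i < j" "j < l" "l \<le> n" "leap n x i < leap n x l" for i j l
      using that assms(1,2) by (auto simp: leap_def split: if_splits)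
    show "\<not> d b < d e" if "1 \<le> e" "e < b" "b < a" "a \<le> n" "d a < d b" for a b e
    proof (rule no_321_if_two_increasing[OF _ that])
      fix z y
      \<comment> \<open>The entries of the first sweep \<open>1, x, x + 2, ..., n\<close>; the
        others form the second increasing sequence.\<close>
      let ?P = "\<lambda>y. y = 1 \<or> x \<le> y \<and> even (y - x)"
      assume zy: "1 \<le> z" "z < y" "y \<le> n" and P: "?P z = ?P y"
      show "d z < d y"
      proof (cases "?P y")
        case True
        then obtain j where j: "y = x + 2 * j" using zy by (metis dvdE le_add_diff_inverse leD)
        show ?thesis
        proof (cases "z = 1")
          case False
          then obtain i where "z = x + 2 * i" using P True by (metis dvdE le_add_diff_inverse)
          then show ?thesis using j zy by (simp add: d_even)
        qed (use j d_even d_1 in simp)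
      next
        case False
        have odd: "2 \<le> v \<and> v < x \<or> (\<exists>j. v = x + 2 * j + 1)" if "1 \<le> v" "\<not> ?P v" for v
          using cases[OF that(1)] that(2) by auto
        have y: "2 \<le> y \<and> y < x \<or> (\<exists>j. y = x + 2 * j + 1)" by (rule odd[OF _ False]) (use zy in simp)
        have z: "2 \<le> z \<and> z < x \<or> (\<exists>j. z = x + 2 * j + 1)" by (rule odd[OF zy(1)]) (use P False in blast)
        show ?thesis
        proof (cases "z < x")
          case True
          then have "d z = r + z" using d_lo z by auto
          then show ?thesis using y d_lo[of y] d_odd zy True by auto
        next
          case False
          then obtain i j where "z = x + 2 * i + 1" "y = x + 2 * j + 1" using y z zy by auto
          then show ?thesis using d_odd[of i] d_odd[of j] zy by simp
        qed
      qed
    qed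
  qed
  then show ?thesis by blast
qed

section \<open>Deleting and inserting the largest entry at the end of the cycle\<close>

text \<open>All other indices stay the same. Only the new value 1 at \<open>t\<close> could create a
  132, and a descent of values to its right already produces a 321 in the old cycle.\<close>

lemma (in avoider) avoider_delete_n:
  assumes n: "n = Suc N" "1 \<le> N" and pn: "\<pi> n = 1"
  shows "avoider N (transpose 1 n \<circ> \<pi>) d"
proof -
  define \<rho> where "\<rho> = transpose 1 n \<circ> \<pi>"
  obtain t where t: "1 \<le> t" "t \<le> n" "\<pi> t = n" using preimage[of n] n by auto
  have tn: "t \<le> N" using t n no_fixpoint[of n] by (cases "t = n") auto
  have rt: "\<rho> t = 1" by (simp add: \<rho>_def t)
  have rn: "\<rho> n = n" by (simp add: \<rho>_def pn)
  have req: "\<rho> y = \<pi> y" if "y \<noteq> t" "y \<noteq> n" for y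
    using that inj[of y t] inj[of y n] t pn by (auto simp: \<rho>_def transpose_def)
  have dt: "d n = Suc (d t)" using d_step[of t] t n by auto
  have dn: "d y < d n" if "1 \<le> y" "y \<le> N" for y using d_less_last[of n y] n pn that by auto
  have pn_n: "\<rho> permutes {1..n}" unfolding \<rho>_def
    by (intro permutes_compose[OF perm] permutes_swap_id) (use n in auto)
  have "avoider N \<rho> d"
  proof
    show "\<rho> permutes {1..N}"
      using pn_n by (rule permutes_superset) (use n rn in \<open>auto simp: le_Suc_eq\<close>)
    show "d 1 = 0" by (rule d_1)
    show "d y < N" if "1 \<le> y" "y \<le> N" for y
      using dn[OF that] d_less[of n] n by auto
    show "d (\<rho> y) = Suc (d y)" if "1 \<le> y" "y \<le> N" "\<rho> y \<noteq> 1" for y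
    proof -
      have "y \<noteq> t" using that rt by auto
      then show ?thesis using req[of y] that n d_step[of y] by auto
    qed
    show "\<not> d b < d e" if "1 \<le> e" "e < b" "b < a" "a \<le> N" "d a < d b" for a b e
      using no_321[of e b a] that n by auto
    show "\<not> \<rho> l < \<rho> j" if *: "1 \<le> i" "i < j" "j < l" "l \<le> N" "\<rho> i < \<rho> l" for i j l
    proof
      assume lj: "\<rho> l < \<rho> j"
      have r1: "1 \<le> \<rho> y" if "1 \<le> y" "y \<le> N" for y
        using permutes_in_image[OF pn_n, of y] that n by auto
      have "l \<noteq> t" "j \<noteq> t" using r1[of i] r1[of l] rt * lj by auto
      then have e: "\<rho> l = \<pi> l" "\<rho> j = \<pi> j" using req * n by auto
      show False
      proof (cases "i = t")
        case False
        then show False using no_132[of i j l] req[of i] e * lj n by auto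
      next
        case True
        \<comment> \<open>Otherwise the cycle is \<open>1, n\<close>, and three positions do not
          fit.\<close>
        have "t \<noteq> 1"
        proof
          assume "t = 1"
          then have "n = 2" using dt d_1 last_entry[of n] pn n by auto
          then show False using * n by auto
        qed
        then have "\<pi> j < \<pi> 1" using around_n[of t 1 j] t True * n by auto
        have ne1: "\<pi> j \<noteq> 1" "\<pi> l \<noteq> 1" using inj[of j n] inj[of l n] pn * n by auto
        have "d j \<noteq> d l" using d_inj[of j l] * n by auto
        moreover have "d l < d t" "d j < d t"
          using dn[of l] dn[of j] dt d_inj[of l t] d_inj[of j t] t * n True
          by (auto simp: less_Suc_eq)
        \<comment> \<open>The triple \<open>l\<close>, \<open>j\<close>, \<open>t\<close> would
          decrease along the cycle.\<close>
        moreover have "\<not> d l < d j" if "d j < d t"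
          using no_321[of t j l] that * t True n by auto
        ultimately have "d j < d l" by linarith
        then have "d (\<pi> j) < d (\<pi> l)" using d_step[of j] d_step[of l] ne1 * n by auto
        moreover have "\<pi> 1 \<noteq> 1" using \<open>\<pi> j < \<pi> 1\<close> ran[of j] * n by auto
        then have "d (\<pi> 1) = 1" using d_step[of 1] d_1 n by auto
        moreover have "d (\<pi> j) \<noteq> 1"
          using d_inj[of "\<pi> j" "\<pi> 1"] \<open>\<pi> j < \<pi> 1\<close> calculation ran[of 1] ran[of j] * n by auto
        moreover have "0 < d (\<pi> j)" using d_pos[of "\<pi> j"] ne1 ran[of j] * n by auto
        \<comment> \<open>\<open>\<pi> 1\<close>, at index 1, then \<open>\<pi> j\<close> and
          \<open>\<pi> l\<close> form the 321.\<close>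
        ultimately show False
          using no_321[of "\<pi> l" "\<pi> j" "\<pi> 1"] lj e \<open>\<pi> j < \<pi> 1\<close> ran[of 1] ran[of l] * n by auto
      qed
    qed
  qed (use n in simp)
  then show ?thesis by (simp add: \<rho>_def)
qed

text \<open>The new value \<open>Suc n\<close> at position \<open>k\<close> could only be the 3 of a
  132, which \<open>before_last_greater\<close> rules out. In the cycle the largest entry comes last
  and so lies in no 321.\<close>

lemma (in avoider) avoider_insert_n:
  shows "avoider (Suc n) (transpose 1 (Suc n) \<circ> \<pi>) (d(Suc n := n))"
proof -
  define \<rho> where "\<rho> = transpose 1 (Suc n) \<circ> \<pi>"
  let ?d = "d(Suc n := n)"
  obtain k where k: "1 \<le> k" "k \<le> n" "\<pi> k = 1" using preimage[of 1] n_pos by auto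
  have "\<pi> (Suc n) = Suc n" using permutes_not_in[OF perm] by auto
  then have rn: "\<rho> (Suc n) = 1" by (simp add: \<rho>_def)
  have rk: "\<rho> k = Suc n" by (simp add: \<rho>_def k)
  have req: "\<rho> y = \<pi> y" if "1 \<le> y" "y \<le> n" "y \<noteq> k" for y
    using that inj[of y k] ran[of y] k by (auto simp: \<rho>_def transpose_def)
  have pn_n: "\<rho> permutes {1..Suc n}" unfolding \<rho>_def
    by (intro permutes_compose permutes_swap_id permutes_subset[OF perm]) auto
  have "avoider (Suc n) \<rho> ?d"
  proof
    show "\<rho> permutes {1..Suc n}" by fact
    show "?d 1 = 0" using d_1 n_pos by auto
    show "?d y < Suc n" if "1 \<le> y" "y \<le> Suc n" for y using d_less[of y] that by auto
    show "?d (\<rho> y) = Suc (?d y)" if y: "1 \<le> y" "y \<le> Suc n" "\<rho> y \<noteq> 1" for y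
    proof -
      have yn: "y \<le> n" using y rn by (cases "y = Suc n") auto
      show ?thesis
      proof (cases "y = k")
        case True
        then show ?thesis using rk last_entry[of k] k n_pos by auto
      next
        case False
        then have "\<rho> y = \<pi> y" using req y yn by auto
        then show ?thesis using d_step[of y] ran[of y] y yn by auto
      qed
    qed
    show "\<not> ?d b < ?d e" if "1 \<le> e" "e < b" "b < a" "a \<le> Suc n" "?d a < ?d b" for a b e
      using no_321[of e b a] d_less[of b] that by (cases "a = Suc n") auto
    show "\<not> \<rho> l < \<rho> j" if *: "1 \<le> i" "i < j" "j < l" "l \<le> Suc n" "\<rho> i < \<rho> l" for i j l
    proof
      assume lj: "\<rho> l < \<rho> j"
      have r: "1 \<le> \<rho> y \<and> \<rho> y \<le> Suc n" if "1 \<le> y" "y \<le> Suc n" for y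
        using permutes_in_image[OF pn_n, of y] that by auto
      have "l \<noteq> Suc n" using rn r[of i] * by auto
      moreover have "l \<noteq> k" using rk r[of j] lj * by auto
      moreover have "i \<noteq> k" using rk r[of l] * by auto
      ultimately have e: "\<rho> l = \<pi> l" "\<rho> i = \<pi> i" "l \<le> n" using req * by auto
      show False
      proof (cases "j = k")
        case True
        then show False using before_last_greater[of k i l] k * e by auto
      next
        case False
        then show False using no_132[of i j l] req[of j] * e lj by auto
      qed
    qed
  qed simp
  then show ?thesis by (simp add: \<rho>_def)
qed

subsection \<open>Counting\<close>

text \<open>Composition with the transposition is an involution, so deletion and insertion are the
  same map.\<close>

lemma card_cyclic_avoiders_last_eq_1:
  assumes "1 \<le> N"
  shows "card {\<pi> \<in> cyclic_avoiders (Suc N) [1, 3, 2] [3, 2, 1]. \<pi> (Suc N) = 1} =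
    card (cyclic_avoiders N [1, 3, 2] [3, 2, 1])" (is "card ?B = card ?A")
proof (rule bij_betw_same_card)
  let ?f = "\<lambda>\<pi>. transpose 1 (Suc N) \<circ> \<pi>"
  have invol: "?f (?f \<pi>) = \<pi>" for \<pi> :: "nat \<Rightarrow> nat" by (simp add: fun_eq_iff)
  show "bij_betw ?f ?B ?A"
  proof (rule bij_betw_byWitness[where f' = ?f])
    show "?f ` ?B \<subseteq> ?A"
    proof (rule image_subsetI)
      fix \<pi> assume B: "\<pi> \<in> ?B"
      then obtain d where "avoider (Suc N) \<pi> d" using cyclic_avoiders_iff[of "Suc N"] by auto
      then interpret avoider "Suc N" \<pi> d .
      show "?f \<pi> \<in> ?A"
        unfolding cyclic_avoiders_iff[OF assms] using avoider_delete_n[of N] assms B by auto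
    qed
    show "?f ` ?A \<subseteq> ?B"
    proof (rule image_subsetI)
      fix \<pi> assume "\<pi> \<in> ?A"
      then obtain d where "avoider N \<pi> d" using cyclic_avoiders_iff[OF assms] by auto
      then interpret avoider N \<pi> d .
      have "\<pi> (Suc N) = Suc N" using permutes_not_in[OF perm] by auto
      then show "?f \<pi> \<in> ?B" using avoider_insert_n cyclic_avoiders_iff[of "Suc N"] by auto
    qed
  qed (use invol in blast)+
qed

text \<open>The range of \<open>m\<close> starts at 2 because \<open>riffle n 1\<close> coincides
  with \<open>leap n n\<close> when \<open>n \<ge> 3\<close>.\<close>

lemma cyclic_avoiders_last_neq_1:
  assumes "2 \<le> n"
  shows "{\<pi> \<in> cyclic_avoiders n [1, 3, 2] [3, 2, 1]. \<pi> n \<noteq> 1} =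
    riffle n ` {2..(n - 1) div 2} \<union> leap n ` {x \<in> {3..n}. even (n - x)}" (is "?L = ?R")
proof
  have n1: "1 \<le> n" using assms by simp
  show "?L \<subseteq> ?R"
  proof
    fix \<pi> assume L: "\<pi> \<in> ?L"
    then obtain d where "avoider n \<pi> d" using cyclic_avoiders_iff[OF n1] by auto
    then interpret avoider n \<pi> d .
    obtain k where k: "1 \<le> k" "k \<le> n" "\<pi> k = 1" using preimage[of 1] n1 by auto
    have k2: "2 \<le> k" using last_ge_2[of k] k assms by simp
    have "k \<noteq> n" using k L by auto
    then consider "n = Suc k" | "n = k + (n - k)" "2 \<le> n - k" using k by linarith
    then show "\<pi> \<in> ?R"
    proof cases
      case 1
      then show ?thesis using eq_leap[of k] k k2 by auto
    next
      case 2
      then have "2 * (n - k) + 1 \<le> n" "\<pi> = riffle n (n - k)"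
        using eq_riffle[of k "n - k"] k by auto
      then show ?thesis using 2(2) by (intro UnI1 image_eqI[of _ _ "n - k"]) auto
    qed
  qed
  show "?R \<subseteq> ?L"
  proof (intro Un_least image_subsetI)
    fix m assume "m \<in> {2..(n - 1) div 2}"
    then have m: "2 \<le> m" "2 * m + 1 \<le> n" by auto
    then have "riffle n m n = Suc m" by (simp add: riffle_def)
    then show "riffle n m \<in> ?L"
      unfolding mem_Collect_eq cyclic_avoiders_iff[OF n1] using avoider_riffle[of m n] m by simp
  next
    fix x assume "x \<in> {x \<in> {3..n}. even (n - x)}"
    then have x: "3 \<le> x" "x \<le> n" "even (n - x)" by auto
    then have "leap n x n = 2" by (simp add: leap_def)
    then show "leap n x \<in> ?L"
      unfolding mem_Collect_eq cyclic_avoiders_iff[OF n1] using avoider_leap[OF x] by simp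
  qed
qed

text \<open>The value at \<open>n\<close> separates the riffles from each other and from all leaps;
  the value at 1 separates the leaps. For \<open>n = 2\<close> both families are empty and the
  truncated difference is 0.\<close>

lemma card_cyclic_avoiders_last_neq_1:
  assumes "2 \<le> n"
  shows "card {\<pi> \<in> cyclic_avoiders n [1, 3, 2] [3, 2, 1]. \<pi> n \<noteq> 1} = 2 * ((n - 1) div 2) - 1"
proof -
  let ?M = "{2..(n - 1) div 2}" and ?X = "{x \<in> {3..n}. even (n - x)}"
  have r: "riffle n m n = Suc m" if "m \<in> ?M" for m
    using that by (auto simp: riffle_def)
  have l1: "leap n x 1 = x" and ln: "leap n x n = 2" if "x \<in> ?X" for x
    using that by (auto simp: leap_def)
  have "inj_on (riffle n) ?M" by (intro inj_onI) (metis r nat.inject)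
  then have cM: "card (riffle n ` ?M) = (n - 1) div 2 - 1" by (simp add: card_image)
  have "inj_on (leap n) ?X" by (intro inj_onI) (metis l1)
  then have "card (leap n ` ?X) = card ?X" by (rule card_image)
  \<comment> \<open>With \<open>x = n - 2 * i\<close>, the bound \<open>x \<ge> 3\<close> becomes
    \<open>i < (n - 1) div 2\<close>.\<close>
  moreover have "?X = (\<lambda>i. n - 2 * i) ` {..<(n - 1) div 2}"
  proof (intro equalityI subsetI)
    fix x assume x: "x \<in> ?X"
    then have "even (n - x)" by blast
    then obtain i where "n - x = 2 * i" by (rule evenE)
    then have "x = n - 2 * i" "i < (n - 1) div 2" using x by auto
    then show "x \<in> (\<lambda>i. n - 2 * i) ` {..<(n - 1) div 2}" by blast
  qed auto
  moreover have "card ((\<lambda>i. n - 2 * i) ` {..<(n - 1) div 2}) = (n - 1) div 2"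
    by (subst card_image) (auto intro!: inj_onI)
  ultimately have cX: "card (leap n ` ?X) = (n - 1) div 2" by metis
  have "Suc m \<noteq> 2" if "m \<in> ?M" for m using that by auto
  then have "riffle n ` ?M \<inter> leap n ` ?X = {}" using r ln by fastforce
  then have "card (riffle n ` ?M \<union> leap n ` ?X) = (n - 1) div 2 - 1 + (n - 1) div 2"
    using cM cX by (subst card_Un_disjoint) auto
  then show ?thesis unfolding cyclic_avoiders_last_neq_1[OF assms] by linarith
qed

lemma num_cyclic_avoiders_Suc:
  assumes "1 \<le> n"
  shows "num_cyclic_avoiders (Suc n) [1, 3, 2] [3, 2, 1] =
    num_cyclic_avoiders n [1, 3, 2] [3, 2, 1] + (2 * (n div 2) - 1)"
proof -
  let ?A = "cyclic_avoiders (Suc n) [1, 3, 2] [3, 2, 1]"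
  have "finite ?A"
    by (rule finite_subset[OF _ finite_permutations[of "{1..Suc n}"]])
      (auto simp: cyclic_avoiders_def)
  moreover have "?A = {\<pi> \<in> ?A. \<pi> (Suc n) = 1} \<union> {\<pi> \<in> ?A. \<pi> (Suc n) \<noteq> 1}" by blast
  ultimately have "card ?A = card {\<pi> \<in> ?A. \<pi> (Suc n) = 1} + card {\<pi> \<in> ?A. \<pi> (Suc n) \<noteq> 1}"
    by (metis (no_types, lifting) card_Un_disjoint disjoint_iff finite_Un mem_Collect_eq)
  then show ?thesis
    using card_cyclic_avoiders_last_eq_1[OF assms] card_cyclic_avoiders_last_neq_1[of "Suc n"] assms
    by (simp add: num_cyclic_avoiders_def)
qed

lemma num_cyclic_avoiders_1: "num_cyclic_avoiders 1 [1, 3, 2] [3, 2, 1] = 1"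
proof -
  have "avoider 1 id (\<lambda>_. 0)" by unfold_locales (auto simp: permutes_id)
  moreover have "\<pi> = id" if "avoider 1 \<pi> d" for \<pi> d
    using avoider.perm[OF that] by simp
  ultimately have "cyclic_avoiders 1 [1, 3, 2] [3, 2, 1] = {id}"
    using cyclic_avoiders_iff[of 1] by auto
  then show ?thesis by (simp add: num_cyclic_avoiders_def)
qed

lemma num_cyclic_avoiders_eq:
  "num_cyclic_avoiders (j + 2) [1, 3, 2] [3, 2, 1] = (j\<^sup>2 + 1) div 2 + 1"
proof (induction j)
  case 0
  \<comment> \<open>At \<open>n = 1\<close> the increment \<open>2 * 0 - 1\<close> is truncated to
    0.\<close>
  show ?case using num_cyclic_avoiders_Suc[of 1] num_cyclic_avoiders_1
    by (simp add: numeral_2_eq_2)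
next
  case (Suc j)
  have "((Suc j)\<^sup>2 + 1) div 2 = (j\<^sup>2 + 1) div 2 + (2 * ((j + 2) div 2) - 1)"
  proof (cases "even j")
    case True
    then obtain i where "j = 2 * i" by blast
    then show ?thesis by (simp add: power2_eq_square algebra_simps)
  next
    case False
    then obtain i where "j = 2 * i + 1" by (blast elim: oddE)
    then show ?thesis by (simp add: power2_eq_square algebra_simps)
  qed
  then show ?case using num_cyclic_avoiders_Suc[of "j + 2"] Suc by simp
qed

lemma ceiling_half: "\<lceil>real m / 2\<rceil> = int ((m + 1) div 2)"
proof (cases "even m")
  case True
  then obtain i where "m = 2 * i" by blast
  then show ?thesis by simp
next
  case False
  then obtain i where "m = 2 * i + 1" by (blast elim: oddE)
  then show ?thesis by (simp add: ceiling_eq_iff field_simps)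
qed

theorem theorem6p6:
  fixes n :: nat
  assumes "n \<ge> 2"
  shows "int (num_cyclic_avoiders n [1, 3, 2] [3, 2, 1]) = \<lceil>(real n - 2)^2 / 2\<rceil> + 1"
proof -
  obtain j where n: "n = j + 2" using assms by (metis le_add_diff_inverse2)
  have "(real n - 2)^2 = real (j\<^sup>2)" by (simp add: n)
  then have "\<lceil>(real n - 2)^2 / 2\<rceil> = int ((j\<^sup>2 + 1) div 2)" using ceiling_half[of "j\<^sup>2"] by simp
  then show ?thesis using num_cyclic_avoiders_eq[of j] n by simp
qed

end
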